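(* Let $X$ be a real Banach space with topological dual $X^*$, let $K\subseteq X$ be convex, and let $A:K\to X^*$ and $a:K\to X$ be two operators. (i) If $A$ is monotone relative to $a$ and $x\in K$ is a solution of the inverted general variational inequality of Stampacchia type $VI_{iS}(A,a,K)$, i.e. $\langle A(y)-A(x),a(x)\rangle\ge 0$ for all $y\in K$, then $x$ is a solution of the inverted general variational inequality of Minty type $VI_{iM}(A,a,K)$, i.e. $\langle A(y)-A(x),a(y)\rangle\ge 0$ for all $y\in K$. (ii) If $A$ is of type strict ql and $a$ is continuous on line segments in $K$, then every solution $x\in K$ of $VI_{iM}(A,a,K)$ (i.e. $\langle A(y)-A(x),a(y)\rangle\ge 0$ for all $y\in K$) is also a solution of $VI_{iS}(A,a,K)$ (i.e. $\langle A(y)-A(x),a(x)\rangle\ge 0$ for all $y\in K$).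
   Context: For $x^*\in X^*$ and $x\in X$, $\langle x^*,x\rangle$ denotes the value of $x^*$ at $x$. $A:K\to X^*$ is monotone relative to $a:K\to X$ if $\langle A(x)-A(y),a(x)-a(y)\rangle\ge 0$ for all $x,y\in K$. For $u,v$ in a real linear space, $[u,v]:=\{(1-t)u+tv: t\in[0,1]\}$ is the closed line segment and $(u,v):=[u,v]\setminus\{u,v\}$ is the open line segment; for $u\ne v$ one has $(u,v)=\{(1-t)u+tv: t\in(0,1)\}$. For real linear spaces $X,Y$ and $D\subseteq X$, an operator $A:D\to Y$ is of type strict ql if for every $x,y\in D$ with $x\neq y$ and every $z\in(x,y)\cap D$ one has $A(z)\in(A(x),A(y))$. An operator $a:K\to X$ is continuous on line segments in $K$ if for every $x\in K$, every $y\in X$, and every real sequence $(t_n)$ converging to $0$ with $x+t_ny\in K$ for all $n$, one has $a(x+t_ny)\to a(x)$ as $n\to\infty$ (in the norm topology of $X$). *)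

theory Defs
  imports "HOL-Analysis.Analysis"
begin

text \<open>
  The dual of \<open>X\<close> is the type \<open>'a \<Rightarrow>\<^sub>L real\<close> of bounded linear functionals, and the pairing
  is \<^const>\<open>blinfun_apply\<close>. An operator with domain \<open>K\<close> is a total function whose values
  outside \<open>K\<close> are irrelevant: every definition below evaluates it at points of \<open>K\<close> only.
\<close>

definition monotone_relative ::
  "('a::real_normed_vector \<Rightarrow> ('a \<Rightarrow>\<^sub>L real)) \<Rightarrow> ('a \<Rightarrow> 'a) \<Rightarrow> 'a set \<Rightarrow> bool" where
  "monotone_relative A a K \<longleftrightarrow>
     (\<forall>x\<in>K. \<forall>y\<in>K. blinfun_apply (A x - A y) (a x - a y) \<ge> 0)"

text \<open>
  By definition, the library's \<open>open_segment u v\<close> is \<open>closed_segment u v - {u, v}\<close>;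
  in particular it is empty if \<open>u = v\<close>.
\<close>

definition strict_ql :: "('a::real_vector \<Rightarrow> 'b::real_vector) \<Rightarrow> 'a set \<Rightarrow> bool" where
  "strict_ql A D \<longleftrightarrow>
     (\<forall>x\<in>D. \<forall>y\<in>D. x \<noteq> y \<longrightarrow>
        (\<forall>z \<in> open_segment x y \<inter> D. A z \<in> open_segment (A x) (A y)))"

definition continuous_on_line_segments ::
  "('a::real_normed_vector \<Rightarrow> 'a) \<Rightarrow> 'a set \<Rightarrow> bool" where
  "continuous_on_line_segments a K \<longleftrightarrow>
     (\<forall>x\<in>K. \<forall>y. \<forall>t :: nat \<Rightarrow> real.
        t \<longlonglongrightarrow> 0 \<longrightarrow> (\<forall>n. x + t n *\<^sub>R y \<in> K) \<longrightarrow>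
        (\<lambda>n. a (x + t n *\<^sub>R y)) \<longlonglongrightarrow> a x)"

definition solves_VI_iS ::
  "('a::real_normed_vector \<Rightarrow> ('a \<Rightarrow>\<^sub>L real)) \<Rightarrow> ('a \<Rightarrow> 'a) \<Rightarrow> 'a set \<Rightarrow> 'a \<Rightarrow> bool" where
  "solves_VI_iS A a K x \<longleftrightarrow>
     x \<in> K \<and> (\<forall>y\<in>K. blinfun_apply (A y - A x) (a x) \<ge> 0)"

definition solves_VI_iM ::
  "('a::real_normed_vector \<Rightarrow> ('a \<Rightarrow>\<^sub>L real)) \<Rightarrow> ('a \<Rightarrow> 'a) \<Rightarrow> 'a set \<Rightarrow> 'a \<Rightarrow> bool" where
  "solves_VI_iM A a K x \<longleftrightarrow>
     x \<in> K \<and> (\<forall>y\<in>K. blinfun_apply (A y - A x) (a y) \<ge> 0)"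

end

theory Submission
  imports Defs
begin

text \<open>Split \<open>a y\<close> as \<open>(a y - a x) + a x\<close>: the functional
  \<open>A y - A x\<close> is nonnegative on the first summand by monotonicity and on the second by
  the Stampacchia inequality.\<close>

lemma VI_iS_imp_iM:
  assumes mono: "monotone_relative A a K" and sol: "solves_VI_iS A a K x"
  shows "solves_VI_iM A a K x"
proof -
  have "blinfun_apply (A y - A x) (a y) \<ge> 0" if "y \<in> K" for y
  proof -
    have "blinfun_apply (A y - A x) (a y - a x) \<ge> 0" "blinfun_apply (A y - A x) (a x) \<ge> 0"
      using mono sol that by (auto simp: monotone_relative_def solves_VI_iS_def)
    then show ?thesis by (simp add: blinfun.diff_right)
  qed
  then show ?thesis using sol by (simp add: solves_VI_iM_def solves_VI_iS_def)
qed

text \<open>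
  For \<open>z\<close> strictly between \<open>x\<close> and \<open>y\<close>, the type strict ql makes \<open>A z - A x\<close> a positive multiple
  of \<open>A y - A x\<close>, so the Minty inequality at \<open>z\<close> says \<open>\<langle>A y - A x, a z\<rangle> \<ge> 0\<close>; let \<open>z\<close> tend to \<open>x\<close>.
\<close>

lemma VI_iM_imp_iS:
  assumes "convex K" and ql: "strict_ql A K" and cont: "continuous_on_line_segments a K"
    and sol: "solves_VI_iM A a K x"
  shows "solves_VI_iS A a K x"
proof -
  have x: "x \<in> K" using sol by (simp add: solves_VI_iM_def)
  have "blinfun_apply (A y - A x) (a x) \<ge> 0" if y: "y \<in> K" for y
  proof (cases "y = x")
    case False
    \<comment> \<open>The sequence is 1/(n+2): starting at 1/2 rather than 1 keeps every
      \<open>z n\<close> different from \<open>y\<close>, as the open segment requires.\<close>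
    define t :: "nat \<Rightarrow> real" where "t n = inverse (real (Suc (Suc n)))" for n
    define z where "z n = x + t n *\<^sub>R (y - x)" for n
    have t: "0 < t n" "t n < 1" for n
      by (auto simp: t_def inverse_eq_divide)
    have t_lim: "t \<longlonglongrightarrow> 0"
      unfolding t_def using LIMSEQ_Suc[OF LIMSEQ_inverse_real_of_nat] .
    have z_eq: "z n = (1 - t n) *\<^sub>R x + t n *\<^sub>R y" for n
      by (simp add: z_def algebra_simps)
    have seg: "z n \<in> open_segment x y" for n
      using False t[of n] z_eq[of n] unfolding in_segment by blast
    then have zK: "z n \<in> K" for n
      using \<open>convex K\<close> x y convex_contains_open_segment by blast
    have nonneg: "blinfun_apply (A y - A x) (a (z n)) \<ge> 0" for n
    proof -
      have "A (z n) \<in> open_segment (A x) (A y)"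
        using ql x y False seg zK by (auto simp: strict_ql_def)
      \<comment> \<open>The parameter \<open>s\<close> depends on \<open>n\<close> and need not
        equal \<open>t n\<close>; only its strict positivity matters, since it allows
        \<open>s\<close> to be cancelled from the Minty inequality at \<open>z n\<close>.\<close>
      then obtain s where s: "0 < s" "A (z n) = (1 - s) *\<^sub>R A x + s *\<^sub>R A y"
        unfolding in_segment by blast
      then have "A (z n) - A x = s *\<^sub>R (A y - A x)"
        by (simp add: algebra_simps)
      moreover have "blinfun_apply (A (z n) - A x) (a (z n)) \<ge> 0"
        using sol zK by (auto simp: solves_VI_iM_def)
      ultimately show ?thesis
        using s(1) by (simp add: blinfun.scaleR_left zero_le_mult_iff)
    qed
    have "(\<lambda>n. a (z n)) \<longlonglongrightarrow> a x"
      using cont x t_lim zK by (auto simp: continuous_on_line_segments_def z_def)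
    \<comment> \<open>After the cancellation the functional no longer varies with \<open>n\<close>;
      only its argument moves, so its boundedness carries the limit through.\<close>
    then have "(\<lambda>n. blinfun_apply (A y - A x) (a (z n))) \<longlonglongrightarrow> blinfun_apply (A y - A x) (a x)"
      by (intro tendsto_intros)
    then show ?thesis using nonneg by (intro LIMSEQ_le_const) auto
  qed simp
  then show ?thesis using x by (simp add: solves_VI_iS_def)
qed

theorem theorem3p3:
  fixes K :: "'a::banach set"
    and A :: "'a \<Rightarrow> ('a \<Rightarrow>\<^sub>L real)"
    and a :: "'a \<Rightarrow> 'a"
  assumes "convex K"
  shows "(monotone_relative A a K \<longrightarrow>
            (\<forall>x. solves_VI_iS A a K x \<longrightarrow> solves_VI_iM A a K x)) \<and>
         (strict_ql A K \<and> continuous_on_line_segments a K \<longrightarrow>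
            (\<forall>x. solves_VI_iM A a K x \<longrightarrow> solves_VI_iS A a K x))"
  using VI_iS_imp_iM VI_iM_imp_iS[OF assms] by blast

end
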